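(* Let $\mathscr A$ be a set of unconditional affects relations over a finite set $S$ of random variables, and let $\mathscr A'\subseteq\mathscr A$ consist of all affects relations in $\mathscr A$ that are both Irred$_1$ and Irred$_3$. Then for any non-degenerate embedding $\mathcal E$ of $S$ into a conical space-time (poset) $\mathcal T$ such that $\mathscr A$ is compatible with $\mathcal E$ (satisfies **compat** ), we have $$(X\vDash Y\mid\mathrm{do}(Z))\in\mathscr A'\quad\Longrightarrow\quad \bar{\mathcal F}_s(\mathcal Y)\subseteq\bar{\mathcal F}_s(\mathcal X)\cap\bar{\mathcal F}_s(\mathcal Z).$$
   Context: **Affects relations.** An (unconditional) affects relation over $S$ is a statement denoted $X\vDash Y\mid\mathrm{do}(Z)$ with $X,Y,Z\subset S$ pairwise disjoint, $X,Y$ non-empty. (In a causal model on a directed graph $\mathcal G$ with observed nodes $S$ it means: there are values $x,z$ with $P_{\mathcal G_{\mathrm{do}(XZ)}}(Y|X=x,Z=z)\neq P_{\mathcal G_{\mathrm{do}(Z)}}(Y|Z=z)$, where $P_{\mathcal G_{\mathrm{do}(I)}}$ is the post-intervention distribution for interventions on $I$.) All properties below are relative to the given set $\mathscr A$: "$X\not\vDash Y\mid\mathrm{do}(Z)$" means that this relation is not in $\mathscr A$. For sets, $AB:=A\cup B$. - $X\vDash Y\mid\mathrm{do}(Z)$ is Red$_1$ if there is a non-empty $s_X\subsetneq X$ with $s_X\not\vDash Y\mid\mathrm{do}((X\setminus s_X)Z)$; Irred$_1$ means not Red$_1$. - It is Red$_3$ if there is a non-empty $s_Z\subseteq Z$ such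 that, with $\tilde s_Z=Z\setminus s_Z$, both $s_Z\not\vDash Y\mid\mathrm{do}(X\tilde s_Z)$ and $s_Z\not\vDash Y\mid\mathrm{do}(\tilde s_Z)$; Irred$_3$ means not Red$_3$. **Space-time.** A space-time is a poset $\mathcal T$; $\bar J^+(x)=\{b\in\mathcal T:b\succeq x\}$; for finite $L\subset\mathcal T$, $f(L)=\bigcap_{x\in L}\bar J^+(x)$, $f(\emptyset)=\mathcal T$. $\mathrm{span}(L)$ is the union of all $L'\subseteq L$ with $f(L')=f(L)$ and no $L''\subsetneq L'$ with $f(L'')=f(L)$. $\mathcal T$ is conical if for all finite $L_i,L_j\subset\mathcal T$, $f(L_i)=f(L_j)$ implies $\mathrm{span}(L_i)=\mathrm{span}(L_j)$. **Embedding.** An embedding $\mathcal E$ of $S$ in $\mathcal T$ is given by a map $O:S\to\mathcal T$; it is non-degenerate if $O$ is injective. For $X\subseteq S$, $\mathcal X$ denotes the corresponding set of ordered random variables $(e,O(e))$, $e\in X$, and $\bar{\mathcal F}_s(\mathcal X):=\bigcap_{e\in X}\bar J^+(O(e))$, with $\bar{\mathcal F}_s(\emptyset)=\mathcal T$. **compat.** $\mathscr A$ is compatible with $\mathcal E$ if for every $(X\vDash Y\mid\mathrm{do}(Z))\in\mathscr A$ that is Irred$_1$, $\bar{\mathcal F}_s(\mathcal Y)\cap\bar{\mathcal F}_s(\mathcal Z)\subseteq\bar{\mathcal F}_s(\mathcal X)$. *)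

theory Defs
  imports Main
begin

text \<open>\<open>Affects X Y Z\<close> stands for the statement that \<open>X\<close> affects \<open>Y\<close> given \<open>do(Z)\<close>.
  It is a formal statement: whether it holds is expressed by its membership in a
  given set \<open>A\<close> of affects relations.\<close>

datatype 'v affects = Affects "'v set" "'v set" "'v set"

definition affects_relations :: "'v set \<Rightarrow> 'v affects set" where
  "affects_relations S =
     {Affects X Y Z | X Y Z.
        X \<subseteq> S \<and> Y \<subseteq> S \<and> Z \<subseteq> S \<and>
        X \<inter> Y = {} \<and> X \<inter> Z = {} \<and> Y \<inter> Z = {} \<and> X \<noteq> {} \<and> Y \<noteq> {}}"

fun red1 :: "'v affects set \<Rightarrow> 'v affects \<Rightarrow> bool" where
  "red1 A (Affects X Y Z) \<longleftrightarrow>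
     (\<exists>sX. sX \<noteq> {} \<and> sX \<subset> X \<and> Affects sX Y ((X - sX) \<union> Z) \<notin> A)"

fun red3 :: "'v affects set \<Rightarrow> 'v affects \<Rightarrow> bool" where
  "red3 A (Affects X Y Z) \<longleftrightarrow>
     (\<exists>sZ. sZ \<noteq> {} \<and> sZ \<subseteq> Z \<and>
        Affects sZ Y (X \<union> (Z - sZ)) \<notin> A \<and> Affects sZ Y (Z - sZ) \<notin> A)"

abbreviation irred1 :: "'v affects set \<Rightarrow> 'v affects \<Rightarrow> bool" where
  "irred1 A r \<equiv> \<not> red1 A r"

abbreviation irred3 :: "'v affects set \<Rightarrow> 'v affects \<Rightarrow> bool" where
  "irred3 A r \<equiv> \<not> red3 A r"

text \<open>A space-time is a poset, given by a type of class \<^class>\<open>order\<close>.\<close>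

definition future :: "'t::order \<Rightarrow> 't set" where
  "future x = {b. x \<le> b}"

definition joint_future :: "'t::order set \<Rightarrow> 't set" where
  "joint_future L = (\<Inter>x\<in>L. future x)"

definition spanning_set :: "'t::order set \<Rightarrow> 't set" where
  "spanning_set L =
     \<Union>{L'. L' \<subseteq> L \<and> joint_future L' = joint_future L \<and>
            \<not> (\<exists>L''. L'' \<subset> L' \<and> joint_future L'' = joint_future L)}"

definition conical :: "'t::order itself \<Rightarrow> bool" where
  "conical _ \<longleftrightarrow>
     (\<forall>Li Lj :: 't set. finite Li \<longrightarrow> finite Lj \<longrightarrow>
        joint_future Li = joint_future Lj \<longrightarrow> spanning_set Li = spanning_set Lj)"

text \<open>An embedding of \<open>S\<close> is a function \<open>loc\<close> of which only the restriction to \<open>S\<close>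
  matters. An ordered random variable is a pair of a random variable and its location.\<close>

definition orvs :: "('v \<Rightarrow> 't) \<Rightarrow> 'v set \<Rightarrow> ('v \<times> 't) set" where
  "orvs loc X = (\<lambda>e. (e, loc e)) ` X"

definition Fs :: "('v \<times> 't::order) set \<Rightarrow> 't set" where
  "Fs XX = (\<Inter>(e, p)\<in>XX. future p)"

definition nondegenerate :: "'v set \<Rightarrow> ('v \<Rightarrow> 't) \<Rightarrow> bool" where
  "nondegenerate S loc \<longleftrightarrow> inj_on loc S"

definition compatible_with :: "'v affects set \<Rightarrow> ('v \<Rightarrow> 't::order) \<Rightarrow> bool" where
  "compatible_with A loc \<longleftrightarrow>
     (\<forall>X Y Z. Affects X Y Z \<in> A \<longrightarrow> irred1 A (Affects X Y Z) \<longrightarrow>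
        Fs (orvs loc Y) \<inter> Fs (orvs loc Z) \<subseteq> Fs (orvs loc X))"

end

theory Submission
  imports Defs
begin

text \<open>Irreducibility, applied to singletons, turns every \<open>w \<in> X \<union> Z\<close> into an affects relation
  from \<open>{w}\<close> to \<open>Y\<close> whose do-set lies in the rest of \<open>X \<union> Z\<close>. Compatibility then makes every
  such \<open>w\<close> individually redundant for the joint future of \<open>X \<union> Y \<union> Z\<close>. In a conical space-time
  a location that is individually redundant lies outside the spanning set, and the locations of
  \<open>X \<union> Z\<close> differ from those of \<open>Y\<close>. So \<open>Y\<close> contains the spanning set, and all of \<open>X \<union> Z\<close> can be
  dropped at once.\<close>

lemma joint_future_antimono: "L' \<subseteq> L \<Longrightarrow> joint_future L \<subseteq> joint_future L'"
  by (auto simp: joint_future_def)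

lemma joint_future_Un: "joint_future (L \<union> L') = joint_future L \<inter> joint_future L'"
  by (auto simp: joint_future_def)

lemma Fs_orvs: "Fs (orvs loc X) = joint_future (loc ` X)"
  by (auto simp: Fs_def orvs_def joint_future_def)

lemma spanning_set_subset: "spanning_set L \<subseteq> L"
  by (auto simp: spanning_set_def)

text \<open>By finiteness some inclusion-minimal subset of \<open>L\<close> keeps the joint future
  of \<open>L\<close>. It is one of the sets united in \<open>spanning_set L\<close>, which is thus
  squeezed between it and \<open>L\<close>.\<close>

lemma joint_future_spanning_set:
  assumes "finite L"
  shows "joint_future (spanning_set L) = joint_future L"
proof -
  let ?E = "{L'. L' \<subseteq> L \<and> joint_future L' = joint_future L}"
  have "finite ?E" and "?E \<noteq> {}"
    using assms by auto
  then obtain L' where L': "L' \<subseteq> L" "joint_future L' = joint_future L"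
    and min: "\<And>L''. L'' \<in> ?E \<Longrightarrow> L'' \<subseteq> L' \<Longrightarrow> L' = L''"
    using finite_has_minimal[of ?E] by auto
  have "joint_future L'' \<noteq> joint_future L" if "L'' \<subset> L'" for L''
    using min[of L''] that L'(1) by auto
  then have "L' \<subseteq> spanning_set L"
    using L' unfolding spanning_set_def by blast
  then have "joint_future (spanning_set L) \<subseteq> joint_future L"
    using L'(2) joint_future_antimono[of L'] by simp
  moreover have "joint_future L \<subseteq> joint_future (spanning_set L)"
    by (rule joint_future_antimono[OF spanning_set_subset])
  ultimately show ?thesis
    by (rule equalityI)
qed

text \<open>Deleting one such \<open>x\<close> keeps the joint future, hence by conicality the
  spanning set, which therefore misses \<open>x\<close>. Without conicality two points might each be
  redundant only because of the other.\<close>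

lemma conical_redundant:
  fixes L M :: "'t::order set"
  assumes "conical TYPE('t)" and "finite L"
    and redundant: "\<And>x. x \<in> L - M \<Longrightarrow> joint_future (L - {x}) \<subseteq> future x"
  shows "joint_future M \<subseteq> joint_future L"
proof -
  have "x \<notin> spanning_set L" if "x \<in> L - M" for x
  proof -
    have "L = L - {x} \<union> {x}"
      using that by blast
    then have "joint_future L = joint_future (L - {x}) \<inter> future x"
      using joint_future_Un[of "L - {x}" "{x}"] by (simp add: joint_future_def)
    then have "joint_future (L - {x}) = joint_future L"
      using redundant[OF that] by blast
    then have "spanning_set (L - {x}) = spanning_set L"
      using assms(1,2) unfolding conical_def by blast
    then show ?thesis
      using spanning_set_subset[of "L - {x}"] by blast
  qed
  then have "spanning_set L \<subseteq> M"
    using spanning_set_subset by blast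
  then show ?thesis
    using joint_future_antimono[of "spanning_set L" M] joint_future_spanning_set[OF assms(2)]
    by simp
qed

text \<open>A singleton has no non-empty proper subset, so compatibility constrains every relation
  in \<open>A\<close> that starts from one.\<close>

lemma irred1_singleton: "irred1 A (Affects {e} Y Z)"
  by auto

lemma irred1_singletonD:
  assumes "Affects X Y Z \<in> A" and "irred1 A (Affects X Y Z)" and "e \<in> X"
  shows "Affects {e} Y ((X - {e}) \<union> Z) \<in> A"
proof (cases "X = {e}")
  case True
  then show ?thesis
    using assms(1) by simp
next
  case False
  then have "{e} \<subset> X"
    using assms(3) by blast
  then show ?thesis
    using assms(2) by auto
qed

lemma irred3_singletonD:
  assumes "irred3 A (Affects X Y Z)" and "e \<in> Z"
  shows "Affects {e} Y (X \<union> (Z - {e})) \<in> A \<or> Affects {e} Y (Z - {e}) \<in> A"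
  using assms by auto

lemma compatible_with_singletonD:
  assumes "compatible_with A loc" and "Affects {e} Y Z \<in> A"
  shows "joint_future (loc ` (Y \<union> Z)) \<subseteq> future (loc e)"
  using assms irred1_singleton[of A e Y Z]
  unfolding compatible_with_def Fs_orvs image_Un joint_future_Un
  by (fastforce simp: joint_future_def)

theorem theorem6p3:
  fixes S :: "'v set"
    and A A' :: "'v affects set"
    and loc :: "'v \<Rightarrow> 't::order"
    and X Y Z :: "'v set"
  assumes "finite S"
    and "A \<subseteq> affects_relations S"
    and "A' = {r \<in> A. irred1 A r \<and> irred3 A r}"
    and "conical TYPE('t)"
    and "nondegenerate S loc"
    and "compatible_with A loc"
    and "Affects X Y Z \<in> A'"
  shows "Fs (orvs loc Y) \<subseteq> Fs (orvs loc X) \<inter> Fs (orvs loc Z)"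
proof -
  let ?W = "X \<union> Y \<union> Z"
  have A: "Affects X Y Z \<in> A" "irred1 A (Affects X Y Z)" "irred3 A (Affects X Y Z)"
    using assms(3,7) by blast+
  have WS: "?W \<subseteq> S" and disjoint: "X \<inter> Y = {}" "X \<inter> Z = {}" "Y \<inter> Z = {}"
    using A(1) assms(2) by (auto simp: affects_relations_def)
  have inj: "inj_on loc ?W"
    using assms(5) WS by (auto simp: nondegenerate_def intro: inj_on_subset)
  have redundant: "joint_future (loc ` ?W - {loc e}) \<subseteq> future (loc e)" if "e \<in> X \<union> Z" for e
  proof -
    \<comment> \<open>For \<open>e\<close> in \<open>Z\<close> it is open which of the two do-sets
      occurs; all that matters is that \<open>V\<close> avoids \<open>e\<close>.\<close>
    have "\<exists>V. Affects {e} Y V \<in> A \<and> V \<subseteq> X \<union> Z - {e}"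
    proof (cases "e \<in> X")
      case True
      moreover have "(X - {e}) \<union> Z \<subseteq> X \<union> Z - {e}"
        using True disjoint by blast
      ultimately show ?thesis
        using irred1_singletonD[OF A(1,2)] by metis
    next
      case False
      then have "e \<in> Z" and "X \<union> (Z - {e}) \<subseteq> X \<union> Z - {e}" and "Z - {e} \<subseteq> X \<union> Z - {e}"
        using that by blast+
      then show ?thesis
        using irred3_singletonD[OF A(3)] by metis
    qed
    then obtain V where V: "Affects {e} Y V \<in> A" "V \<subseteq> X \<union> Z - {e}"
      by blast
    have "e \<notin> Y"
      using that disjoint by blast
    then have "Y \<union> V \<subseteq> ?W - {e}"
      using V(2) by blast
    \<comment> \<open>Non-degeneracy enters here: no other variable of \<open>?W\<close> shares the
      location of \<open>e\<close>, so removing that location loses only \<open>e\<close>.\<close>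
    moreover have "loc ` (?W - {e}) = loc ` ?W - {loc e}"
      using inj that by (subst inj_on_image_set_diff[of loc ?W]) auto
    ultimately have "loc ` (Y \<union> V) \<subseteq> loc ` ?W - {loc e}"
      by blast
    then show ?thesis
      using compatible_with_singletonD[OF assms(6) V(1)] joint_future_antimono by blast
  qed
  have "joint_future (loc ` Y) \<subseteq> joint_future (loc ` ?W)"
  proof (rule conical_redundant[OF assms(4)])
    show "finite (loc ` ?W)"
      using WS assms(1) finite_subset by blast
    \<comment> \<open>A location of \<open>?W\<close> that no variable of \<open>Y\<close> occupies
      belongs to some \<open>e\<close> in \<open>X \<union> Z\<close>.\<close>
    show "joint_future (loc ` ?W - {x}) \<subseteq> future x" if "x \<in> loc ` ?W - loc ` Y" for x
      using that redundant by blast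
  qed
  then show ?thesis
    unfolding Fs_orvs image_Un joint_future_Un by blast
qed

end
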